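(* Let $G$ be a (finite, simple, undirected) graph on $n$ vertices and $W$ its adjacency matrix, with smallest eigenvalue $\lambda_n$. Let $\mathcal{S}=\mathcal{E}(W)$ be an arbitrary orthonormal basis of $\mathbb{R}^n$ consisting of eigenvectors of $W$, and let $W_n$ be the eigenspace of $W$ corresponding to $\lambda_n$. Suppose the dimension of $W_n$ is $k$ with $n>k\ge1$. Suppose there exists an orthonormal basis $\mathcal{U}=\{u_1,\dots,u_k\}$ of $W_n$ such that the $k\times n$ matrix $A$ with rows $u_1,\dots,u_k$ has columns of constant $2$-norm, i.e. there exists $c>0$ such that $\|A_j\|_2=c$ for all $j\in[n]$, where $A_j$ denotes the $j$-th column of $A$. Then $z_{SD_{\mathcal{S}}}=-n\lambda_n$, and in particular $$z_{SP_{\mathcal{S}}}=z_{GW}=z_{SD_{\mathcal{S}}}.$$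
   Context: $\mathbb{S}^n$ is the set of real symmetric $n\times n$ matrices, $\langle A,B\rangle=\mathrm{tr}(AB)$, $[n]=\{1,\dots,n\}$. For a finite set $\mathcal{S}=\{v_1,\dots,v_s\}\subseteq\mathbb{R}^n$ define the following optimal values: $$z_{GW}=\max\{\langle -W,X\rangle:\ X\in\mathbb{S}^n,\ X\succeq0,\ X_{ii}=1\ \forall i\in[n]\},$$ $$z_{SP_{\mathcal{S}}}=\max\{\langle -W,X\rangle:\ X\in\mathbb{S}^n,\ v^\top Xv\ge0\ \forall v\in\mathcal{S},\ X_{ii}=1\ \forall i\in[n],\ |X_{ij}|\le1\ \forall i,j\in[n]\},$$ $$z_{SD_{\mathcal{S}}}=\max\Big\{\Big\langle -W,\sum_{i=1}^s\eta_iv_iv_i^\top\Big\rangle:\ \eta\in\mathbb{R}^s,\ \eta_i\ge0\ \forall i,\ \Big(\sum_{i=1}^s\eta_iv_iv_i^\top\Big)_{jj}\le1\ \forall j\in[n]\Big\}.$$ *)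

theory Defs
  imports "HOL-Analysis.Analysis"
begin

definition simple_graph :: "('n::finite \<Rightarrow> 'n \<Rightarrow> bool) \<Rightarrow> bool" where
  "simple_graph E \<longleftrightarrow> symp E \<and> irreflp E"

definition adjacency_matrix :: "('n::finite \<Rightarrow> 'n \<Rightarrow> bool) \<Rightarrow> real^'n^'n" where
  "adjacency_matrix E = (\<chi> i j. if E i j then 1 else 0)"

definition is_eigenvector :: "real^'n^'n \<Rightarrow> real \<Rightarrow> real^'n \<Rightarrow> bool" where
  "is_eigenvector A l v \<longleftrightarrow> v \<noteq> 0 \<and> A *v v = l *\<^sub>R v"

definition is_eigenvalue :: "real^'n^'n \<Rightarrow> real \<Rightarrow> bool" where
  "is_eigenvalue A l \<longleftrightarrow> (\<exists>v. is_eigenvector A l v)"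

definition is_smallest_eigenvalue :: "real^'n^'n \<Rightarrow> real \<Rightarrow> bool" where
  "is_smallest_eigenvalue A l \<longleftrightarrow> is_eigenvalue A l \<and> (\<forall>m. is_eigenvalue A m \<longrightarrow> l \<le> m)"

definition eigenspace :: "real^'n^'n \<Rightarrow> real \<Rightarrow> (real^'n) set" where
  "eigenspace A l = {v. A *v v = l *\<^sub>R v}"

definition orthonormal_basis :: "(real^'n) set \<Rightarrow> (real^'n) set \<Rightarrow> bool" where
  "orthonormal_basis B V \<longleftrightarrow>
     pairwise orthogonal B \<and> (\<forall>v\<in>B. norm v = 1) \<and> span B = V"

definition mat_inner :: "real^'n^'n \<Rightarrow> real^'n^'n \<Rightarrow> real" where
  "mat_inner A B = trace (A ** B)"

definition symmetric_mat :: "real^'n^'n \<Rightarrow> bool" where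
  "symmetric_mat X \<longleftrightarrow> transpose X = X"

definition psd :: "real^'n^'n \<Rightarrow> bool" where
  "psd X \<longleftrightarrow> symmetric_mat X \<and> (\<forall>v. v \<bullet> (X *v v) \<ge> 0)"

definition outer_prod :: "real^'n \<Rightarrow> real^'n \<Rightarrow> real^'n^'n" where
  "outer_prod v w = (\<chi> i j. v $ i * w $ j)"

text \<open>The weights are indexed by the vectors of \<open>S\<close> themselves; only finite \<open>S\<close> is meaningful.\<close>

definition conic_sum :: "(real^'n) set \<Rightarrow> (real^'n \<Rightarrow> real) \<Rightarrow> real^'n^'n" where
  "conic_sum S \<eta> = (\<Sum>v\<in>S. \<eta> v *\<^sub>R outer_prod v v)"

definition GW_values :: "real^'n^'n \<Rightarrow> real set" where
  "GW_values W = {mat_inner (- W) X | X. symmetric_mat X \<and> psd X \<and> (\<forall>i. X $ i $ i = 1)}"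

definition SP_values :: "real^'n^'n \<Rightarrow> (real^'n) set \<Rightarrow> real set" where
  "SP_values W S = {mat_inner (- W) X | X. symmetric_mat X \<and> (\<forall>v\<in>S. v \<bullet> (X *v v) \<ge> 0)
     \<and> (\<forall>i. X $ i $ i = 1) \<and> (\<forall>i j. \<bar>X $ i $ j\<bar> \<le> 1)}"

definition SD_values :: "real^'n^'n \<Rightarrow> (real^'n) set \<Rightarrow> real set" where
  "SD_values W S = {mat_inner (- W) (conic_sum S \<eta>) | \<eta>. (\<forall>v\<in>S. \<eta> v \<ge> 0)
     \<and> (\<forall>j. conic_sum S \<eta> $ j $ j \<le> 1)}"

text \<open>The library's \<open>Greatest\<close> is unspecified when there is no maximum, so statements about the
  optimal values below are to be accompanied by \<open>has_max\<close>.\<close>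

definition has_max :: "real set \<Rightarrow> bool" where
  "has_max A \<longleftrightarrow> (\<exists>m\<in>A. \<forall>a\<in>A. a \<le> m)"

definition z_GW :: "real^'n^'n \<Rightarrow> real" where
  "z_GW W = (GREATEST z. z \<in> GW_values W)"

definition z_SP :: "real^'n^'n \<Rightarrow> (real^'n) set \<Rightarrow> real" where
  "z_SP W S = (GREATEST z. z \<in> SP_values W S)"

definition z_SD :: "real^'n^'n \<Rightarrow> (real^'n) set \<Rightarrow> real" where
  "z_SD W S = (GREATEST z. z \<in> SD_values W S)"

end

theory Submission
  imports Defs
begin

text \<open>All three programmes are controlled by one identity. For an orthonormal eigenbasis \<open>S\<close> of the
  symmetric matrix \<open>W\<close>, with eigenvalues \<open>l v\<close>, evaluating the trace in that basis gives
  \<open>trace (W ** X) = (\<Sum>v\<in>S. l v * (v \<bullet> (X *v v)))\<close>. Whenever the quadratic form of \<open>X\<close> is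
  nonnegative on \<open>S\<close>, this is at least \<open>\<mu> * trace X\<close> (\<open>trace_eigenbasis_lower_bound\<close>). Each feasible
  \<open>X\<close> of each programme satisfies that sign condition, and \<open>trace X\<close> is \<open>n\<close>, or at most \<open>n\<close> in the
  conic programme; as \<open>\<mu> \<le> 0\<close> for the zero-diagonal matrix \<open>W\<close>, every objective value is bounded by
  \<open>- n * \<mu>\<close>.

  The bound is attained simultaneously by a scaled orthogonal projection onto the \<open>\<mu>\<close>-eigenspace.
  The projection does not depend on the orthonormal basis it is built from
  (\<open>eigenprojection_basis_independent\<close>): built from those members
  of \<open>S\<close> that lie in the eigenspace it is a conic combination of the \<open>v v\<^sup>T\<close> with \<open>v \<in> S\<close>, and built
  from \<open>u\<close> it has the constant diagonal \<open>c\<^sup>2\<close>. Dividing by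
  \<open>c\<^sup>2\<close> makes the diagonal equal to one, and then positive semidefiniteness bounds all the entries
  (\<open>psd_unit_diagonal_entry_le\<close>).\<close>

section \<open>Conic sums of rank-one projections\<close>

lemma conic_sum_entry: "conic_sum S \<eta> $ i $ j = (\<Sum>v\<in>S. \<eta> v * (v $ i * v $ j))"
  by (simp add: conic_sum_def outer_prod_def)

lemma conic_sum_mult_vec: "conic_sum S \<eta> *v x = (\<Sum>v\<in>S. (\<eta> v * (v \<bullet> x)) *\<^sub>R v)"
proof (simp add: vec_eq_iff, intro allI)
  fix i
  have "(conic_sum S \<eta> *v x) $ i = (\<Sum>j\<in>UNIV. \<Sum>v\<in>S. \<eta> v * (v $ i * v $ j) * x $ j)"
    by (simp add: matrix_vector_mult_def conic_sum_entry sum_distrib_right)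
  also have "\<dots> = (\<Sum>v\<in>S. \<Sum>j\<in>UNIV. \<eta> v * (v $ i * v $ j) * x $ j)"
    by (rule sum.swap)
  also have "\<dots> = (\<Sum>v\<in>S. \<eta> v * (v \<bullet> x) * v $ i)"
    by (simp add: inner_vec_def sum_distrib_left sum_distrib_right mult_ac)
  finally show "(conic_sum S \<eta> *v x) $ i = (\<Sum>v\<in>S. \<eta> v * (v \<bullet> x) * v $ i)" .
qed

lemma trace_mult_conic_sum:
  fixes M :: "real^'n^'n"
  shows "trace (M ** conic_sum S \<eta>) = (\<Sum>v\<in>S. \<eta> v * (v \<bullet> (M *v v)))"
proof -
  have "trace (M ** conic_sum S \<eta>)
      = (\<Sum>i\<in>UNIV. \<Sum>j\<in>UNIV. \<Sum>v\<in>S. \<eta> v * (v $ i * (M $ i $ j * v $ j)))"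
    by (simp add: trace_def matrix_matrix_mult_def conic_sum_entry sum_distrib_left mult_ac)
  also have "\<dots> = (\<Sum>i\<in>UNIV. \<Sum>v\<in>S. \<Sum>j\<in>UNIV. \<eta> v * (v $ i * (M $ i $ j * v $ j)))"
    by (intro sum.cong refl sum.swap)
  also have "\<dots> = (\<Sum>v\<in>S. \<Sum>i\<in>UNIV. \<Sum>j\<in>UNIV. \<eta> v * (v $ i * (M $ i $ j * v $ j)))"
    by (rule sum.swap)
  also have "\<dots> = (\<Sum>v\<in>S. \<eta> v * (v \<bullet> (M *v v)))"
    by (simp add: inner_vec_def matrix_vector_mult_def sum_distrib_left)
  finally show ?thesis .
qed

lemma symmetric_conic_sum: "symmetric_mat (conic_sum S \<eta>)"
  by (simp add: symmetric_mat_def vec_eq_iff transpose_def conic_sum_entry mult_ac)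

lemma psd_conic_sum:
  assumes "\<forall>v\<in>S. \<eta> v \<ge> 0"
  shows "psd (conic_sum S \<eta>)"
proof -
  have "x \<bullet> (conic_sum S \<eta> *v x) = (\<Sum>v\<in>S. \<eta> v * (v \<bullet> x)\<^sup>2)" for x
    by (simp add: conic_sum_mult_vec inner_sum_right inner_commute power2_eq_square mult_ac)
  then show ?thesis
    using assms by (auto simp: psd_def symmetric_conic_sum intro!: sum_nonneg)
qed

text \<open>Testing the quadratic form on \<open>e\<^sub>i + e\<^sub>j\<close> and \<open>e\<^sub>i - e\<^sub>j\<close> shows that a semidefinite matrix with
  unit diagonal satisfies the entry bounds of the polyhedral relaxation; this makes that relaxation
  weaker than the semidefinite one.\<close>

lemma psd_unit_diagonal_entry_le:
  fixes X :: "real^'n^'n"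
  assumes "psd X" and diag: "\<forall>i. X $ i $ i = 1"
  shows "\<bar>X $ i $ j\<bar> \<le> 1"
proof -
  have sym: "X $ j $ i = X $ i $ j"
    using assms(1) unfolding psd_def symmetric_mat_def by (metis transpose_def vec_lambda_beta)
  have entry: "axis a 1 \<bullet> (X *v axis b 1) = X $ a $ b" for a b
    by (simp add: inner_axis' matrix_vector_mult_basis column_def)
  have "0 \<le> (axis i 1 + axis j 1) \<bullet> (X *v (axis i 1 + axis j 1))"
    "0 \<le> (axis i 1 - axis j 1) \<bullet> (X *v (axis i 1 - axis j 1))"
    using assms(1) by (auto simp: psd_def)
  then show ?thesis
    using sym diag by (simp add: inner_add_left inner_add_right inner_diff_left inner_diff_right
        matrix_vector_right_distrib matrix_vector_mult_diff_distrib entry)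
qed

section \<open>Orthonormal bases and the trace\<close>

lemma orthonormal_basis_finite: "orthonormal_basis B V \<Longrightarrow> finite B"
  by (simp add: orthonormal_basis_def pairwise_orthogonal_imp_finite)

lemma orthonormal_basis_inner:
  assumes "orthonormal_basis B V" "v \<in> B" "w \<in> B"
  shows "v \<bullet> w = (if v = w then 1 else 0)"
  using assms by (auto simp: orthonormal_basis_def pairwise_def orthogonal_def norm_eq_1)

lemma conic_sum_mult_basis_vec:
  assumes "orthonormal_basis B V" "T \<subseteq> B" "w \<in> B"
  shows "conic_sum T \<eta> *v w = (if w \<in> T then \<eta> w *\<^sub>R w else 0)"
proof -
  have fin: "finite T"
    using assms(1,2) orthonormal_basis_finite finite_subset by blast
  have "conic_sum T \<eta> *v w = (\<Sum>v\<in>T. if v = w then \<eta> w *\<^sub>R w else 0)"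
    unfolding conic_sum_mult_vec
    by (rule sum.cong) (use assms orthonormal_basis_inner[OF assms(1) _ assms(3)] in auto)
  then show ?thesis using fin by simp
qed

lemma matrix_eqI_on_spanning:
  fixes M N :: "real^'n^'m"
  assumes "span B = UNIV" and "\<And>w. w \<in> B \<Longrightarrow> M *v w = N *v w"
  shows "M = N"
proof -
  have "M *v x = N *v x" for x
    by (rule linear_eq_on[of "(*v) M" "(*v) N" x B])
      (use assms in \<open>auto intro: matrix_vector_mul_linear\<close>)
  then show ?thesis by (simp add: matrix_eq)
qed

lemma conic_sum_orthonormal_basis_fixes:
  assumes "orthonormal_basis B V" "x \<in> V"
  shows "conic_sum B (\<lambda>_. 1) *v x = x"
proof -
  have "x \<in> span B" using assms by (simp add: orthonormal_basis_def)
  moreover have "conic_sum B (\<lambda>_. 1) *v w = id w" if "w \<in> B" for w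
    using conic_sum_mult_basis_vec[OF assms(1) order_refl that] that by simp
  ultimately have "conic_sum B (\<lambda>_. 1) *v x = id x"
    by (intro linear_eq_on[of "(*v) (conic_sum B (\<lambda>_. 1))" id x B])
      (auto intro: matrix_vector_mul_linear linear_id)
  then show ?thesis by simp
qed

text \<open>The rank-one projections of an orthonormal basis of the whole space resolve the identity, so
  the trace may be computed in that basis.\<close>

lemma trace_orthonormal_basis:
  fixes M :: "real^'n^'n"
  assumes "orthonormal_basis S UNIV"
  shows "trace M = (\<Sum>v\<in>S. v \<bullet> (M *v v))"
proof -
  have "conic_sum S (\<lambda>_. 1) = mat 1"
    by (simp add: matrix_eq conic_sum_orthonormal_basis_fixes[OF assms])
  then show ?thesis
    using trace_mult_conic_sum[of M S "\<lambda>_. 1"] by simp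
qed

section \<open>Eigenbases of symmetric matrices\<close>

lemma symmetric_mat_inner_swap:
  fixes W :: "real^'n^'n"
  assumes "symmetric_mat W"
  shows "v \<bullet> (W *v w) = (W *v v) \<bullet> w"
  using assms dot_lmul_matrix[of v W w] unfolding symmetric_mat_def
  by (metis matrix_transpose_mul transpose_matrix_vector)

lemma eigenvectors_orthogonal:
  fixes W :: "real^'n^'n"
  assumes "symmetric_mat W" "W *v v = a *\<^sub>R v" "W *v w = b *\<^sub>R w" "a \<noteq> b"
  shows "v \<bullet> w = 0"
  using symmetric_mat_inner_swap[OF assms(1), of v w] assms(2-4) by simp

text \<open>This is the common source of the three upper bounds: in an eigenbasis the trace of \<open>W ** X\<close> is a
  combination of the eigenvalues with the nonnegative weights \<open>v \<bullet> (X *v v)\<close>, which add up to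
  \<open>trace X\<close>.\<close>

lemma trace_eigenbasis_lower_bound:
  fixes W X :: "real^'n^'n"
  assumes sym: "symmetric_mat W" and min: "is_smallest_eigenvalue W \<mu>"
    and S: "orthonormal_basis S UNIV" and eig: "\<forall>v\<in>S. \<exists>l. is_eigenvector W l v"
    and pos: "\<forall>v\<in>S. v \<bullet> (X *v v) \<ge> 0"
  shows "\<mu> * trace X \<le> trace (W ** X)"
proof -
  have "\<mu> * trace X = (\<Sum>v\<in>S. \<mu> * (v \<bullet> (X *v v)))"
    by (simp add: trace_orthonormal_basis[OF S] sum_distrib_left)
  also have "\<dots> \<le> (\<Sum>v\<in>S. v \<bullet> ((W ** X) *v v))"
  proof (rule sum_mono)
    fix v assume v: "v \<in> S"
    then obtain l where l: "is_eigenvector W l v" using eig by blast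
    then have "\<mu> \<le> l"
      using min unfolding is_smallest_eigenvalue_def is_eigenvalue_def by blast
    moreover have "v \<bullet> ((W ** X) *v v) = l * (v \<bullet> (X *v v))"
      using l symmetric_mat_inner_swap[OF sym, of v "X *v v"]
      by (simp add: is_eigenvector_def matrix_vector_mul_assoc[symmetric])
    ultimately show "\<mu> * (v \<bullet> (X *v v)) \<le> v \<bullet> ((W ** X) *v v)"
      using pos v by (simp add: mult_right_mono)
  qed
  also have "\<dots> = trace (W ** X)"
    by (simp add: trace_orthonormal_basis[OF S])
  finally show ?thesis .
qed

text \<open>Both matrices are the orthogonal projection onto the eigenspace. It is enough to compare them on
  the eigenbasis \<open>S\<close>: members of the eigenspace are fixed by both, and the remaining members of \<open>S\<close>
  belong to other eigenvalues, hence are orthogonal to the eigenspace and annihilated by both. That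
  \<open>S \<inter> eigenspace W \<mu>\<close> spans the eigenspace is thus a consequence of the comparison, not an input.\<close>

lemma eigenprojection_basis_independent:
  fixes W :: "real^'n^'n"
  assumes sym: "symmetric_mat W"
    and S: "orthonormal_basis S UNIV" and eig: "\<forall>v\<in>S. \<exists>l. is_eigenvector W l v"
    and U: "orthonormal_basis U (eigenspace W \<mu>)"
  shows "conic_sum (S \<inter> eigenspace W \<mu>) (\<lambda>_. 1) = conic_sum U (\<lambda>_. 1)"
proof (rule matrix_eqI_on_spanning[of S])
  show "span S = UNIV" using S by (simp add: orthonormal_basis_def)
next
  fix w assume w: "w \<in> S"
  have lhs: "conic_sum (S \<inter> eigenspace W \<mu>) (\<lambda>_. 1) *v w = (if w \<in> eigenspace W \<mu> then w else 0)"
    using conic_sum_mult_basis_vec[OF S _ w, of "S \<inter> eigenspace W \<mu>" "\<lambda>_. 1"] w by simp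
  show "conic_sum (S \<inter> eigenspace W \<mu>) (\<lambda>_. 1) *v w = conic_sum U (\<lambda>_. 1) *v w"
  proof (cases "w \<in> eigenspace W \<mu>")
    case True
    then show ?thesis using lhs conic_sum_orthonormal_basis_fixes[OF U] by simp
  next
    case False
    obtain l where l: "W *v w = l *\<^sub>R w"
      using eig w unfolding is_eigenvector_def by blast
    have "v \<bullet> w = 0" if "v \<in> U" for v
    proof -
      have "v \<in> eigenspace W \<mu>"
        using U that span_base unfolding orthonormal_basis_def by blast
      then show ?thesis
        using eigenvectors_orthogonal[OF sym _ l, of v \<mu>] False l by (auto simp: eigenspace_def)
    qed
    then have "conic_sum U (\<lambda>_. 1) *v w = 0" by (simp add: conic_sum_mult_vec)
    then show ?thesis using lhs False by simp
  qed
qed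

section \<open>Equality of the three optimal values\<close>

lemma mat_inner_uminus_left:
  fixes W X :: "real^'n^'n"
  shows "mat_inner (- W) X = - trace (W ** X)"
  by (simp add: mat_inner_def trace_def matrix_matrix_mult_def sum_negf)

lemma max_eqI:
  fixes m :: real
  assumes "m \<in> A" "\<And>a. a \<in> A \<Longrightarrow> a \<le> m"
  shows "has_max A \<and> (GREATEST z. z \<in> A) = m"
  using assms by (auto simp: has_max_def intro: Greatest_equality)

theorem theorem6:
  fixes E :: "'n::finite \<Rightarrow> 'n \<Rightarrow> bool"
    and W :: "real^'n^'n" and S :: "(real^'n) set" and \<mu> :: real and k :: nat
    and u :: "'k::finite \<Rightarrow> real^'n" and A :: "real^'n^'k" and c :: real
  assumes "simple_graph E"
    and "W = adjacency_matrix E"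
    and "is_smallest_eigenvalue W \<mu>"
    and "orthonormal_basis S UNIV" and "\<forall>v\<in>S. \<exists>l. is_eigenvector W l v"
    and "dim (eigenspace W \<mu>) = k" and "1 \<le> k" and "k < CARD('n)"
    and "CARD('k) = k" and "inj u" and "orthonormal_basis (range u) (eigenspace W \<mu>)"
    and "A = (\<chi> i. u i)"
    and "c > 0" and "\<forall>j. norm (column j A) = c"
  shows "has_max (SD_values W S) \<and> has_max (SP_values W S) \<and> has_max (GW_values W) \<and>
    z_SD W S = - real CARD('n) * \<mu> \<and> z_SP W S = z_GW W \<and> z_GW W = z_SD W S"
proof -
  note S = assms(4) and eig = assms(5)
  let ?n = "real CARD('n)"
  have sym: "symmetric_mat W"
    using assms(1,2) by (auto simp: symmetric_mat_def vec_eq_iff transpose_def adjacency_matrix_def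
        simple_graph_def dest: sympD)
  note bound = trace_eigenbasis_lower_bound[OF sym assms(3) S eig]
  have trace_diag: "trace X = ?n" if "\<forall>i. X $ i $ i = 1" for X :: "real^'n^'n"
    using that by (simp add: trace_def)

  \<comment> \<open>The trace bound at the identity matrix: the eigenvalues of a loopless graph sum to zero.\<close>
  have "trace W = 0"
    using assms(1,2) by (simp add: trace_def adjacency_matrix_def simple_graph_def irreflp_def)
  then have "\<mu> * ?n \<le> 0"
    using bound[of "mat 1"] by (simp add: trace_I)
  then have mu: "\<mu> \<le> 0" by (simp add: mult_le_0_iff)

  define T where "T = S \<inter> eigenspace W \<mu>"
  define \<eta> where "\<eta> v = (if v \<in> T then 1 / c\<^sup>2 else 0)" for v
  define X where "X = conic_sum S \<eta>"
  have finS: "finite S" using S by (rule orthonormal_basis_finite)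
  have X_proj: "X $ i $ j = conic_sum (range u) (\<lambda>_. 1) $ i $ j / c\<^sup>2" for i j
  proof -
    have "X $ i $ j = (\<Sum>v\<in>T. (v $ i * v $ j) / c\<^sup>2)"
      unfolding X_def conic_sum_entry
      by (rule sum.mono_neutral_cong_right) (auto simp: finS T_def \<eta>_def)
    also have "\<dots> = conic_sum T (\<lambda>_. 1) $ i $ j / c\<^sup>2"
      by (simp add: conic_sum_entry sum_divide_distrib)
    finally show ?thesis
      using eigenprojection_basis_independent[OF sym S eig assms(11)] by (simp add: T_def)
  qed
  have X_diag: "\<forall>j. X $ j $ j = 1"
  proof
    fix j
    have "conic_sum (range u) (\<lambda>_. 1) $ j $ j = (\<Sum>i\<in>UNIV. u i $ j * u i $ j)"
      using assms(10) by (simp add: conic_sum_entry sum.reindex)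
    also have "\<dots> = column j A \<bullet> column j A"
      by (simp add: inner_vec_def column_def assms(12))
    also have "\<dots> = c\<^sup>2"
      using assms(14) by (simp add: power2_norm_eq_inner[symmetric])
    finally show "X $ j $ j = 1" using X_proj assms(13) by simp
  qed
  have \<eta>: "\<forall>v\<in>S. \<eta> v \<ge> 0" by (simp add: \<eta>_def)
  have X_psd: "psd X" unfolding X_def by (rule psd_conic_sum[OF \<eta>])
  have X_val: "mat_inner (- W) X = - ?n * \<mu>"
  proof -
    have "trace (W ** X) = (\<Sum>v\<in>S. \<eta> v * (v \<bullet> (W *v v)))"
      unfolding X_def by (rule trace_mult_conic_sum)
    also have "\<dots> = (\<Sum>v\<in>S. \<mu> * (\<eta> v * (v \<bullet> v)))"
      by (rule sum.cong) (auto simp: \<eta>_def T_def eigenspace_def)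
    also have "\<dots> = \<mu> * trace X"
      using trace_mult_conic_sum[of "mat 1" S \<eta>] by (simp add: X_def sum_distrib_left)
    finally show ?thesis
      using trace_diag[OF X_diag] by (simp add: mat_inner_uminus_left)
  qed

  have GW: "has_max (GW_values W) \<and> z_GW W = - ?n * \<mu>"
    unfolding z_GW_def
  proof (rule max_eqI)
    show "- ?n * \<mu> \<in> GW_values W"
      using X_val X_psd X_diag unfolding GW_values_def psd_def by (smt (verit) mem_Collect_eq)
  next
    fix z assume "z \<in> GW_values W"
    then obtain Y where "z = mat_inner (- W) Y" "psd Y" "\<forall>i. Y $ i $ i = 1"
      unfolding GW_values_def by blast
    then show "z \<le> - ?n * \<mu>"
      using bound[of Y] trace_diag[of Y] by (simp add: mat_inner_uminus_left psd_def mult.commute)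
  qed
  have SP: "has_max (SP_values W S) \<and> z_SP W S = - ?n * \<mu>"
    unfolding z_SP_def
  proof (rule max_eqI)
    show "- ?n * \<mu> \<in> SP_values W S"
      using X_val X_psd X_diag psd_unit_diagonal_entry_le[OF X_psd X_diag]
      unfolding SP_values_def psd_def by (smt (verit) mem_Collect_eq)
  next
    fix z assume "z \<in> SP_values W S"
    then obtain Y where "z = mat_inner (- W) Y" "\<forall>v\<in>S. v \<bullet> (Y *v v) \<ge> 0" "\<forall>i. Y $ i $ i = 1"
      unfolding SP_values_def by blast
    then show "z \<le> - ?n * \<mu>"
      using bound[of Y] trace_diag[of Y] by (simp add: mat_inner_uminus_left mult.commute)
  qed
  have SD: "has_max (SD_values W S) \<and> z_SD W S = - ?n * \<mu>"
    unfolding z_SD_def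
  proof (rule max_eqI)
    show "- ?n * \<mu> \<in> SD_values W S"
      using X_val X_diag \<eta> unfolding SD_values_def X_def by (smt (verit) mem_Collect_eq)
  next
    fix z assume "z \<in> SD_values W S"
    then obtain \<theta> where z: "z = mat_inner (- W) (conic_sum S \<theta>)" and \<theta>: "\<forall>v\<in>S. \<theta> v \<ge> 0"
      and diag: "\<forall>j. conic_sum S \<theta> $ j $ j \<le> 1"
      unfolding SD_values_def by blast
    have "trace (conic_sum S \<theta>) \<le> ?n"
      unfolding trace_def using sum_bounded_above[of UNIV "\<lambda>j. conic_sum S \<theta> $ j $ j" 1] diag by simp
    then have "\<mu> * ?n \<le> \<mu> * trace (conic_sum S \<theta>)"
      using mu by (rule mult_left_mono_neg)
    also have "\<dots> \<le> trace (W ** conic_sum S \<theta>)"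
      using bound psd_conic_sum[OF \<theta>] by (simp add: psd_def)
    finally show "z \<le> - ?n * \<mu>"
      using z by (simp add: mat_inner_uminus_left mult.commute)
  qed
  show ?thesis using GW SP SD by simp
qed

end
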